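(* Let $n\ge 1$ and let $\psi: \mathrm{Aut}(F_n)\to GL_n(\mathbb{Z})$ be the abelianization map. The image $\psi(\Pi A(F_n))$ of the palindromic automorphism group $\Pi A(F_n)$ is exactly $\widehat{GL_n(\mathbb{Z})}$, the set of all matrices in $GL_n(\mathbb{Z})$ in which each row and each column has exactly one odd entry.
   Context: $F_n$ is the free group with free generating set $S=\{a_1,\dots,a_n\}$. For a reduced word $w=x_1x_2\cdots x_k$ with letters $x_i\in S\cup S^{-1}$, let $\bar w=x_k\cdots x_2x_1$ be the word obtained by reversing the order of the letters. A reduced word $w$ is palindromic if $w=\bar w$. A palindromic automorphism of $F_n$ is an automorphism of $F_n$ that maps each generator $a_i$ to (an element whose reduced word is) a palindromic word. The collection of all palindromic automorphisms is a subgroup of $\mathrm{Aut}(F_n)$, denoted $\Pi A(F_n)$. The abelianization map $\psi$ is defined as follows: for $\alpha\in\mathrm{Aut}(F_n)$, the $(i,j)$-entry of $\psi(\alpha)$ is the sum of the exponents of the letter $a_j$ in $\alpha(a_i)$. $\widehat{GL_n(\mathbb{Z})}$ is a subgroup of $GL_n(\mathbb{Z})$; it is the preimage of the group of permutation matrices under reduction modulo $2$. *)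

theory Defs
  imports
    "HOL-Algebra.Bij"
    "HOL-Library.Z2"
    "HOL-Combinatorics.Permutations"
    "Jordan_Normal_Form.Matrix"
begin

section \<open>Free groups of finite rank\<close>

text \<open>The letter \<open>(True, i)\<close> is the generator with index \<open>i\<close>, and \<open>(False, i)\<close> is its formal inverse.
  Generators are indexed by \<open>{..<n}\<close>, matching the row and column indices of matrices.\<close>

type_synonym letter = "bool \<times> nat"

definition inv_letter :: "letter \<Rightarrow> letter" where
  "inv_letter x = (\<not> fst x, snd x)"

definition reduced :: "letter list \<Rightarrow> bool" where
  "reduced w \<longleftrightarrow> successively (\<lambda>x y. y \<noteq> inv_letter x) w"

text \<open>Left multiplication of a reduced word by a letter, cancelling if necessary.\<close>

fun push_letter :: "letter \<Rightarrow> letter list \<Rightarrow> letter list" where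
  "push_letter x [] = [x]"
| "push_letter x (y # w) = (if y = inv_letter x then w else x # y # w)"

text \<open>Elements are reduced words; the product of two of them is the reduced form of their
  concatenation.\<close>

definition free_group :: "nat \<Rightarrow> letter list monoid" where
  "free_group n =
    \<lparr>carrier = {w. reduced w \<and> snd ` set w \<subseteq> {..<n}},
     monoid.mult = foldr push_letter,
     one = []\<rparr>"

definition gen :: "nat \<Rightarrow> letter list" where
  "gen i = [(True, i)]"

lemma inv_letter_inv_letter [simp]: "inv_letter (inv_letter x) = x"
  by (simp add: inv_letter_def)

lemma snd_inv_letter [simp]: "snd (inv_letter x) = snd x"
  by (simp add: inv_letter_def)

lemma inv_letter_neq [simp]: "inv_letter x \<noteq> x" "x \<noteq> inv_letter x"
  by (cases x; simp add: inv_letter_def)+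

lemma reduced_Nil [simp]: "reduced []"
  by (simp add: reduced_def)

lemma reduced_Cons:
  "reduced (x # w) \<longleftrightarrow> (w = [] \<or> hd w \<noteq> inv_letter x) \<and> reduced w"
  by (auto simp: reduced_def successively_Cons)

lemma reduced_push_letter: "reduced w \<Longrightarrow> reduced (push_letter x w)"
  by (cases w) (auto simp: reduced_Cons)

lemma set_push_letter: "set (push_letter x w) \<subseteq> insert x (set w)"
  by (cases w) auto

lemma push_letter_inv: "reduced w \<Longrightarrow> push_letter x (push_letter (inv_letter x) w) = w"
  by (cases w; cases "tl w") (auto simp: reduced_Cons)

lemma reduced_foldr_push: "reduced v \<Longrightarrow> reduced (foldr push_letter u v)"
  by (induction u) (auto simp: reduced_push_letter)

lemma set_foldr_push: "set (foldr push_letter u v) \<subseteq> set u \<union> set v"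
proof (induction u)
  case (Cons x u)
  then show ?case
    using set_push_letter[of x "foldr push_letter u v"] by auto
qed simp

lemma foldr_push_Nil: "reduced w \<Longrightarrow> foldr push_letter w [] = w"
proof (induction w)
  case (Cons x w)
  then show ?case
    by (cases w) (auto simp: reduced_Cons)
qed simp

lemma foldr_push_letter_left:
  "reduced w \<Longrightarrow> foldr push_letter (push_letter x v) w = push_letter x (foldr push_letter v w)"
proof (cases v)
  case (Cons y v')
  assume "reduced w"
  with Cons show ?thesis
    using push_letter_inv[OF reduced_foldr_push, of w x v'] by auto
qed simp

lemma foldr_push_assoc:
  "reduced w \<Longrightarrow>
    foldr push_letter (foldr push_letter u v) w = foldr push_letter u (foldr push_letter v w)"
  by (induction u) (auto simp: foldr_push_letter_left)

lemma foldr_push_inverse: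
  "foldr push_letter (rev (map inv_letter w)) w = []"
  by (induction w) simp_all

lemma reduced_inverse: "reduced w \<Longrightarrow> reduced (rev (map inv_letter w))"
  unfolding reduced_def successively_rev successively_map
  by (erule successively_mono) auto

lemma group_free_group: "group (free_group n)"
proof (rule groupI)
  fix u v assume uv: "u \<in> carrier (free_group n)" "v \<in> carrier (free_group n)"
  then show "u \<otimes>\<^bsub>free_group n\<^esub> v \<in> carrier (free_group n)"
    using image_mono[OF set_foldr_push[of u v], of snd] reduced_foldr_push[of v u]
    by (simp add: free_group_def image_Un) blast
next
  fix u v w assume "w \<in> carrier (free_group n)"
  then show "u \<otimes>\<^bsub>free_group n\<^esub> v \<otimes>\<^bsub>free_group n\<^esub> w = u \<otimes>\<^bsub>free_group n\<^esub> (v \<otimes>\<^bsub>free_group n\<^esub> w)"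
    by (simp add: free_group_def foldr_push_assoc)
next
  fix w assume w: "w \<in> carrier (free_group n)"
  have "rev (map inv_letter w) \<in> carrier (free_group n)"
    using w by (auto simp: free_group_def reduced_inverse)
  then show "\<exists>v\<in>carrier (free_group n). v \<otimes>\<^bsub>free_group n\<^esub> w = \<one>\<^bsub>free_group n\<^esub>"
    by (rule bexI[rotated]) (simp add: free_group_def foldr_push_inverse)
qed (auto simp: free_group_def)

section \<open>Palindromic automorphisms\<close>

definition palindromic :: "letter list \<Rightarrow> bool" where
  "palindromic w \<longleftrightarrow> w = rev w"

definition PiA :: "nat \<Rightarrow> (letter list \<Rightarrow> letter list) set" where
  "PiA n = {\<alpha> \<in> auto (free_group n). \<forall>i<n. palindromic (\<alpha> (gen i))}"

section \<open>The abelianization map\<close>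

definition exponent_sum :: "nat \<Rightarrow> letter list \<Rightarrow> int" where
  "exponent_sum j w = (\<Sum>x\<leftarrow>w. if snd x = j then (if fst x then 1 else - 1) else 0)"

definition abelianization :: "nat \<Rightarrow> (letter list \<Rightarrow> letter list) \<Rightarrow> int mat" where
  "abelianization n \<alpha> = mat n n (\<lambda>(i, j). exponent_sum j (\<alpha> (gen i)))"

section \<open>Matrix groups\<close>

definition GL_int :: "nat \<Rightarrow> int mat set" where
  "GL_int n = Units (ring_mat TYPE(int) n ())"

definition permutation_matrices :: "nat \<Rightarrow> 'a :: zero_neq_one mat set" where
  "permutation_matrices n =
    {mat n n (\<lambda>(i, j). if j = p i then 1 else 0) | p. p permutes {..<n}}"

text \<open>The type \<open>bit\<close> is the field with two elements, so \<open>map_mat of_int\<close> is reduction modulo 2.\<close>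

definition GL_hat :: "nat \<Rightarrow> int mat set" where
  "GL_hat n = {A \<in> GL_int n. (map_mat of_int A :: bit mat) \<in> permutation_matrices n}"

end

theory Submission
  imports Defs "Jordan_Normal_Form.Gauss_Jordan_Elimination"
begin

text \<open>A palindrome has at most one letter of odd exponent sum, so the matrix of a palindromic
  automorphism has at most one odd entry per row; being invertible modulo 2, it reduces to a
  permutation matrix. Conversely, up to a permutation of the generators a matrix in \<open>GL_hat n\<close> is
  congruent to the identity modulo 2, and a Euclidean algorithm that only adds \<open>\<plusminus>2\<close> times a row to
  another one turns it into a diagonal matrix with entries \<open>\<plusminus>1\<close>. Each of these row operations
  comes from an automorphism \<open>a\<^sub>i \<mapsto> a\<^sub>j\<^sup>\<plusminus> a\<^sub>i a\<^sub>j\<^sup>\<plusminus>\<close>. Palindromic automorphisms are closed under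
  composition because they are exactly those that commute with reversing words.\<close>

section \<open>Reversal and exponent sums of words\<close>

lemma free_group_simps [simp]:
  "carrier (free_group n) = {w. reduced w \<and> snd ` set w \<subseteq> {..<n}}"
  "monoid.mult (free_group n) = foldr push_letter"
  "one (free_group n) = []"
  by (simp_all add: free_group_def)

lemma reduced_rev: "reduced (rev w) \<longleftrightarrow> reduced w"
proof -
  have "reduced (rev w)" if "reduced w" for w
    using that unfolding reduced_def successively_rev
    by (rule successively_mono) auto
  from this[of w] this[of "rev w"] show ?thesis by auto
qed

text \<open>A cancellation at the front of a word becomes, after reversal, a cancellation at its
  end.\<close>

lemma rev_push_letter:
  assumes "reduced w"
  shows "rev (push_letter x w) = foldr push_letter (rev w) [x]"
proof (cases w)
  case (Cons y v)
  show ?thesis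
  proof (cases "y = inv_letter x")
    case True
    have "reduced (rev v)"
      using assms Cons by (simp add: reduced_rev reduced_Cons)
    then show ?thesis
      using Cons True by (simp add: foldr_push_Nil)
  next
    case False
    have "reduced (rev w @ [x])"
      using assms Cons False reduced_rev[of "x # w"] by (simp add: reduced_Cons)
    from foldr_push_Nil[OF this] show ?thesis
      using Cons False by simp
  qed
qed simp

text \<open>Here \<open>u\<close> is an arbitrary word, so its reversal enters through its reduced
  form; associativity absorbs the letter that moves to the end.\<close>

lemma rev_foldr_push:
  assumes "reduced v"
  shows "rev (foldr push_letter u v) = foldr push_letter (rev v) (foldr push_letter (rev u) [])"
proof (induction u)
  case Nil
  show ?case
    using assms by (simp add: foldr_push_Nil reduced_rev)
next
  case (Cons x u)
  have "rev (foldr push_letter (x # u) v) = foldr push_letter (rev (foldr push_letter u v)) [x]"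
    using assms by (simp add: rev_push_letter reduced_foldr_push)
  also have "\<dots> = foldr push_letter (rev v) (foldr push_letter (foldr push_letter (rev u) []) [x])"
    unfolding Cons.IH by (rule foldr_push_assoc) (simp add: reduced_Cons)
  also have "foldr push_letter (foldr push_letter (rev u) []) [x] =
      foldr push_letter (rev u) (foldr push_letter [] [x])"
    by (rule foldr_push_assoc) (simp add: reduced_Cons)
  finally show ?case
    by simp
qed

text \<open>Reversal is an anti-automorphism of the free group, and palindromes are its fixed
  points.\<close>

lemma rev_mult:
  "reduced u \<Longrightarrow> reduced v \<Longrightarrow> rev (foldr push_letter u v) = foldr push_letter (rev v) (rev u)"
  by (simp add: rev_foldr_push foldr_push_Nil reduced_rev)

section \<open>Exponent sums and their parity on palindromes\<close>

lemma exponent_sum_Nil [simp]: "exponent_sum j [] = 0"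
  by (simp add: exponent_sum_def)

lemma exponent_sum_Cons:
  "exponent_sum j (x # w) = (if snd x = j then (if fst x then 1 else - 1) else 0) + exponent_sum j w"
  by (simp add: exponent_sum_def)

lemma exponent_sum_append: "exponent_sum j (u @ v) = exponent_sum j u + exponent_sum j v"
  by (simp add: exponent_sum_def)

text \<open>A cancelled pair of letters contributes zero to every exponent sum.\<close>

lemma exponent_sum_foldr_push:
  "exponent_sum j (foldr push_letter u v) = exponent_sum j u + exponent_sum j v"
proof (induction u)
  case (Cons x u)
  have "exponent_sum j (push_letter x w) = exponent_sum j (x # w)" for w
    by (cases w) (auto simp: exponent_sum_Cons inv_letter_def)
  then show ?case
    using Cons by (simp add: exponent_sum_Cons)
qed simp

lemma odd_exponent_sum_Cons:
  "odd (exponent_sum j (x # w)) \<longleftrightarrow> (snd x = j) \<noteq> odd (exponent_sum j w)"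
  by (simp add: exponent_sum_Cons)

lemma palindromic_Cons_snoc: "palindromic (x # v @ [y]) \<longleftrightarrow> y = x \<and> palindromic v"
  unfolding palindromic_def
  by (simp only: rev.simps rev_append append_Cons append_Nil list.inject append1_eq_conv) blast

text \<open>Removing the equal outer letters of a palindrome changes each exponent sum by 0, 2 or
  -2, so parities survive down to the middle, which is empty or a single letter.\<close>

lemma palindromic_odd_exponent_unique:
  assumes "palindromic w" "odd (exponent_sum j w)" "odd (exponent_sum k w)"
  shows "j = k"
  using assms
proof (induction w rule: length_induct)
  case (1 w)
  show ?case
  proof (cases w)
    case Nil
    then show ?thesis
      using 1(2,3) by simp
  next
    case (Cons x u)
    show ?thesis
    proof (cases u rule: rev_cases)
      case Nil
      then show ?thesis
        using 1(3,4) unfolding Cons odd_exponent_sum_Cons by simp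
    next
      case (snoc v y)
      then have "palindromic (x # v @ [y])"
        using 1(2) Cons by metis
      then have "y = x" "palindromic v"
        unfolding palindromic_Cons_snoc by blast+
      moreover have "odd (exponent_sum i v)" if "odd (exponent_sum i w)" for i
        using that Cons snoc \<open>y = x\<close>
        by (cases "snd x = i") (simp_all add: odd_exponent_sum_Cons exponent_sum_append)
      moreover have "length v < length w"
        using Cons snoc by simp
      ultimately show ?thesis
        using 1(1,3,4) by blast
    qed
  qed
qed

section \<open>Automorphisms of free groups\<close>

lemma letter_in_free_group: "snd x < n \<Longrightarrow> [x] \<in> carrier (free_group n)"
  by (simp add: reduced_Cons)

lemma gen_in_free_group: "i < n \<Longrightarrow> gen i \<in> carrier (free_group n)"
  unfolding gen_def by (rule letter_in_free_group) simp

lemma auto_closed: "\<alpha> \<in> auto (free_group n) \<Longrightarrow> w \<in> carrier (free_group n) \<Longrightarrow> \<alpha> w \<in> carrier (free_group n)"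
  unfolding auto_def hom_def by blast

lemma auto_Nil:
  assumes "\<alpha> \<in> auto (free_group n)"
  shows "\<alpha> [] = []"
  using hom_one[of \<alpha> "free_group n" "free_group n"] assms group_free_group
  by (simp add: auto_def)

lemma auto_mult:
  assumes "\<alpha> \<in> auto (free_group n)" "u \<in> carrier (free_group n)" "v \<in> carrier (free_group n)"
  shows "\<alpha> (foldr push_letter u v) = foldr push_letter (\<alpha> u) (\<alpha> v)"
  using hom_mult[of \<alpha> "free_group n" "free_group n" u v] assms
  by (simp add: auto_def)

lemma auto_Cons:
  assumes "\<alpha> \<in> auto (free_group n)" "x # w \<in> carrier (free_group n)"
  shows "\<alpha> (x # w) = foldr push_letter (\<alpha> [x]) (\<alpha> w)"
proof -
  have "[x] \<in> carrier (free_group n)" "w \<in> carrier (free_group n)" and r: "reduced (x # w)"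
    using assms(2) by (auto simp: reduced_Cons)
  from auto_mult[OF assms(1) this(1,2)] have "\<alpha> (push_letter x w) = foldr push_letter (\<alpha> [x]) (\<alpha> w)"
    by simp
  also have "push_letter x w = x # w"
    using r by (cases w) (auto simp: reduced_Cons)
  finally show ?thesis .
qed

lemma auto_letter_inverse:
  assumes "\<alpha> \<in> auto (free_group n)" "snd x < n"
  shows "foldr push_letter (\<alpha> [x]) (\<alpha> [inv_letter x]) = []"
  using auto_mult[OF assms(1) letter_in_free_group[of x] letter_in_free_group[of "inv_letter x"]]
    assms by (simp add: auto_Nil)

text \<open>Exponent sums are additive, so \<open>\<alpha>\<close> acts linearly on them: the
  exponent vector of \<open>w\<close> is multiplied on the right by the matrix of
  \<open>\<alpha>\<close>.\<close>

lemma exponent_sum_auto: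
  assumes "\<alpha> \<in> auto (free_group n)" "w \<in> carrier (free_group n)"
  shows "exponent_sum j (\<alpha> w) = (\<Sum>l<n. exponent_sum l w * exponent_sum j (\<alpha> (gen l)))"
  using assms(2)
proof (induction w)
  case Nil
  then show ?case
    using assms(1) by (simp add: auto_Nil)
next
  case (Cons x w)
  have l: "snd x < n" and w: "w \<in> carrier (free_group n)"
    using Cons.prems by (auto simp: reduced_Cons)
  have "exponent_sum j (\<alpha> [x]) + exponent_sum j (\<alpha> [inv_letter x]) = 0"
    using arg_cong[OF auto_letter_inverse[OF assms(1) l], of "exponent_sum j"]
    by (simp add: exponent_sum_foldr_push)
  then have "exponent_sum j (\<alpha> [x]) = (if fst x then 1 else - 1) * exponent_sum j (\<alpha> (gen (snd x)))"
    by (cases x) (auto simp: gen_def inv_letter_def)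
  also have "\<dots> = (\<Sum>l<n. exponent_sum l [x] * exponent_sum j (\<alpha> (gen l)))"
    using l by (subst sum.remove[of _ "snd x"]) (auto simp: exponent_sum_Cons)
  finally have "exponent_sum j (\<alpha> [x]) = (\<Sum>l<n. exponent_sum l [x] * exponent_sum j (\<alpha> (gen l)))" .
  then show ?case
    using Cons.IH[OF w] auto_Cons[OF assms(1) Cons.prems]
    by (simp add: exponent_sum_foldr_push exponent_sum_Cons distrib_right sum.distrib)
qed

section \<open>Palindromic automorphisms and reversal\<close>

text \<open>\<open>PiA\<close> constrains the images of generators only. For an inverse letter, the
  image and its reversal are both inverses of the same palindrome, hence equal.\<close>

lemma PiA_palindromic_letter:
  assumes "\<alpha> \<in> PiA n" "snd x < n"
  shows "palindromic (\<alpha> [x])"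
proof -
  interpret group "free_group n"
    by (rule group_free_group)
  have a: "\<alpha> \<in> auto (free_group n)" and g: "palindromic (\<alpha> (gen (snd x)))"
    using assms by (auto simp: PiA_def)
  define y z where "y = \<alpha> [x]" and "z = \<alpha> [inv_letter x]"
  have yz: "y \<in> carrier (free_group n)" "z \<in> carrier (free_group n)"
    unfolding y_def z_def using assms(2) by (intro auto_closed[OF a] letter_in_free_group; simp)+
  have zy: "foldr push_letter z y = []"
    using auto_letter_inverse[OF a, of "inv_letter x"] assms(2) by (simp add: y_def z_def)
  show ?thesis
  proof (cases "fst x")
    case True
    then show ?thesis
      using g by (cases x) (simp add: gen_def)
  next
    case False
    then have "rev z = z"
      using g by (cases x) (simp add: gen_def inv_letter_def z_def palindromic_def)
    moreover have "foldr push_letter (rev y) (rev z) = []"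
      using rev_mult[of z y] yz zy by simp
    ultimately have "foldr push_letter (rev y) z = []"
      by simp
    moreover have "rev y \<in> carrier (free_group n)"
      using yz by (simp add: reduced_rev)
    ultimately have "rev y = inv\<^bsub>free_group n\<^esub> z"
      using inv_equality[of "rev y" z] yz by simp
    moreover have "y = inv\<^bsub>free_group n\<^esub> z"
      using inv_comm[of z y] inv_equality[of y z] yz zy by simp
    ultimately show ?thesis
      by (simp add: palindromic_def y_def)
  qed
qed

text \<open>Applying \<open>\<alpha>\<close> before or after \<open>rev\<close> reverses products
  either way, and the two results agree on letters because their images are palindromes.\<close>

lemma PiA_rev:
  assumes "\<alpha> \<in> PiA n" "w \<in> carrier (free_group n)"
  shows "\<alpha> (rev w) = rev (\<alpha> w)"
proof -
  have a: "\<alpha> \<in> auto (free_group n)"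
    using assms(1) by (simp add: PiA_def)
  show ?thesis
    using assms(2)
  proof (induction w)
    case Nil
    then show ?case
      using a by (simp add: auto_Nil)
  next
    case (Cons x w)
    have x: "snd x < n" and w: "w \<in> carrier (free_group n)" "rev w \<in> carrier (free_group n)"
      and r: "reduced (rev w @ [x])"
      using Cons.prems reduced_rev[of "x # w"] by (auto simp: reduced_Cons reduced_rev)
    have "\<alpha> (rev (x # w)) = \<alpha> (foldr push_letter (rev w) [x])"
      using foldr_push_Nil[OF r] by simp
    also have "\<dots> = foldr push_letter (rev (\<alpha> w)) (\<alpha> [x])"
      using auto_mult[OF a w(2) letter_in_free_group[OF x]] Cons.IH[OF w(1)] by simp
    also have "\<alpha> [x] = rev (\<alpha> [x])"
      using PiA_palindromic_letter[OF assms(1) x] by (simp add: palindromic_def)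
    also have "foldr push_letter (rev (\<alpha> w)) \<dots> = rev (foldr push_letter (\<alpha> [x]) (\<alpha> w))"
      using auto_closed[OF a letter_in_free_group[OF x]] auto_closed[OF a w(1)]
      by (simp add: rev_mult)
    also have "\<dots> = rev (\<alpha> (x # w))"
      using auto_Cons[OF a Cons.prems] by simp
    finally show ?case .
  qed
qed

text \<open>\<open>compose\<close> restricts to the carrier because members of \<open>auto\<close>
  are extensional functions; it is the product of \<open>BijGroup\<close>.\<close>

lemma auto_compose:
  assumes "\<alpha> \<in> auto (free_group n)" "\<beta> \<in> auto (free_group n)"
  shows "compose (carrier (free_group n)) \<alpha> \<beta> \<in> auto (free_group n)"
  using subgroup.m_closed[OF group.subgroup_auto[OF group_free_group] assms] assms
  by (simp add: BijGroup_def auto_def)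

lemma PiA_compose:
  assumes "\<alpha> \<in> PiA n" "\<beta> \<in> PiA n"
  shows "compose (carrier (free_group n)) \<alpha> \<beta> \<in> PiA n"
proof -
  have "palindromic (compose (carrier (free_group n)) \<alpha> \<beta> (gen i))" if "i < n" for i
  proof -
    have "rev (\<beta> (gen i)) = \<beta> (gen i)" "\<beta> (gen i) \<in> carrier (free_group n)"
      using assms(2) that auto_closed[OF _ gen_in_free_group[OF that]]
      by (auto simp: PiA_def palindromic_def)
    then have "palindromic (\<alpha> (\<beta> (gen i)))"
      using PiA_rev[OF assms(1), of "\<beta> (gen i)"] by (simp add: palindromic_def)
    then show ?thesis
      using gen_in_free_group[OF that] by (simp add: compose_eq)
  qed
  then show ?thesis
    using assms auto_compose[of \<alpha> n \<beta>] by (simp add: PiA_def)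
qed

section \<open>The abelianization matrix\<close>

lemma abelianization_carrier [simp]: "abelianization n \<alpha> \<in> carrier_mat n n"
  by (simp add: abelianization_def)

text \<open>The factors change order because the exponent vectors of the images form the rows, on
  which matrices act from the right.\<close>

lemma abelianization_compose:
  assumes "\<alpha> \<in> auto (free_group n)" "\<beta> \<in> auto (free_group n)"
  shows "abelianization n (compose (carrier (free_group n)) \<alpha> \<beta>) = abelianization n \<beta> * abelianization n \<alpha>"
proof (rule eq_matI)
  fix i j
  assume "i < dim_row (abelianization n \<beta> * abelianization n \<alpha>)"
    and "j < dim_col (abelianization n \<beta> * abelianization n \<alpha>)"
  then have ij: "i < n" "j < n"
    by (simp_all add: abelianization_def)
  have "exponent_sum j (\<alpha> (\<beta> (gen i))) =
      (\<Sum>l<n. exponent_sum l (\<beta> (gen i)) * exponent_sum j (\<alpha> (gen l)))"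
    using ij(1) by (intro exponent_sum_auto assms auto_closed[OF assms(2)] gen_in_free_group)
  then show "abelianization n (compose (carrier (free_group n)) \<alpha> \<beta>) $$ (i, j) =
      (abelianization n \<beta> * abelianization n \<alpha>) $$ (i, j)"
    using ij gen_in_free_group[OF ij(1)]
    by (simp add: abelianization_def compose_eq scalar_prod_def atLeast0LessThan)
qed (simp_all add: abelianization_def)

lemma abelianization_id: "abelianization n (\<lambda>w \<in> carrier (free_group n). w) = 1\<^sub>m n"
  by (rule eq_matI)
    (auto simp: abelianization_def gen_def exponent_sum_Cons reduced_Cons)

lemma GL_int_iff:
  "A \<in> GL_int n \<longleftrightarrow> A \<in> carrier_mat n n \<and> (\<exists>B \<in> carrier_mat n n. B * A = 1\<^sub>m n \<and> A * B = 1\<^sub>m n)"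
  by (simp add: GL_int_def Units_def ring_mat_simps)

lemma GL_int_mult: "A \<in> GL_int n \<Longrightarrow> B \<in> GL_int n \<Longrightarrow> A * B \<in> GL_int n"
  using monoid.Units_m_closed[OF ring.is_monoid[OF ring_mat[where 'a = int]], of A n "()" B]
  by (simp add: GL_int_def ring_mat_simps)

lemma abelianization_GL_int:
  assumes "\<alpha> \<in> auto (free_group n)"
  shows "abelianization n \<alpha> \<in> GL_int n"
proof -
  let ?F = "free_group n"
  let ?\<beta> = "inv\<^bsub>BijGroup (carrier ?F)\<^esub> \<alpha>"
  interpret group "BijGroup (carrier ?F)"
    by (rule group_BijGroup)
  have \<beta>: "?\<beta> \<in> auto ?F"
    by (rule subgroup.m_inv_closed[OF group.subgroup_auto[OF group_free_group] assms])
  have "\<alpha> \<in> carrier (BijGroup (carrier ?F))"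
    using assms by (simp add: BijGroup_def auto_def)
  from l_inv[OF this] r_inv[OF this]
  have "compose (carrier ?F) ?\<beta> \<alpha> = (\<lambda>w \<in> carrier ?F. w)"
    "compose (carrier ?F) \<alpha> ?\<beta> = (\<lambda>w \<in> carrier ?F. w)"
    using assms \<beta> by (simp_all add: BijGroup_def auto_def)
  then show ?thesis
    unfolding GL_int_iff
    using abelianization_compose[OF assms \<beta>] abelianization_compose[OF \<beta> assms] abelianization_id[of n]
    by (intro conjI bexI[of _ "abelianization n ?\<beta>"]) auto
qed

text \<open>This allows a matrix to be lifted factor by factor; the automorphisms are composed in
  the order opposite to the matrices.\<close>

lemma abelianization_PiA_mult:
  assumes "A \<in> abelianization n ` PiA n" "B \<in> abelianization n ` PiA n"
  shows "A * B \<in> abelianization n ` PiA n"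
proof -
  obtain \<alpha> \<beta> where ab: "\<alpha> \<in> PiA n" "\<beta> \<in> PiA n" "A = abelianization n \<alpha>" "B = abelianization n \<beta>"
    using assms by blast
  then have "A * B = abelianization n (compose (carrier (free_group n)) \<beta> \<alpha>)"
    by (simp add: abelianization_compose PiA_def del: free_group_simps)
  then show ?thesis
    using PiA_compose[OF ab(2,1)] by blast
qed

section \<open>Lifting elementary matrices\<close>

text \<open>The endomorphism prescribed by the images of letters, as in the universal property of
  free groups. Inverse letters receive images of their own, and \<open>inverse_compatible\<close>
  makes these respect cancellation.\<close>

definition subst_word :: "(letter \<Rightarrow> letter list) \<Rightarrow> letter list \<Rightarrow> letter list" where
  "subst_word f w = foldr push_letter (concat (map f w)) []"

definition inverse_compatible :: "(letter \<Rightarrow> letter list) \<Rightarrow> bool" where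
  "inverse_compatible f \<longleftrightarrow> (\<forall>x. f (inv_letter x) = rev (map inv_letter (f x)))"

lemma subst_word_Cons: "subst_word f (x # w) = foldr push_letter (f x) (subst_word f w)"
  by (simp add: subst_word_def)

lemma reduced_subst_word: "reduced (subst_word f w)"
  by (simp add: subst_word_def reduced_foldr_push)

lemma foldr_push_cancel:
  "reduced v \<Longrightarrow> foldr push_letter u (foldr push_letter (rev (map inv_letter u)) v) = v"
  by (induction u arbitrary: v) (simp_all add: reduced_push_letter push_letter_inv)

text \<open>Where \<open>push_letter\<close> cancels, \<open>f x\<close> meets its formal inverse
  and cancels as well, so the substitution is well defined on the free group.\<close>

lemma subst_word_push_letter:
  assumes "inverse_compatible f"
  shows "subst_word f (push_letter x w) = foldr push_letter (f x) (subst_word f w)"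
proof (cases w)
  case Nil
  then show ?thesis by (simp add: subst_word_Cons)
next
  case (Cons y v)
  have "f (inv_letter x) = rev (map inv_letter (f x))"
    using assms unfolding inverse_compatible_def by blast
  then show ?thesis
    using Cons foldr_push_cancel[OF reduced_subst_word, of "f x" f v]
    by (simp add: subst_word_Cons)
qed

lemma subst_word_foldr_push:
  assumes "inverse_compatible f"
  shows "subst_word f (foldr push_letter u v) = foldr push_letter (subst_word f u) (subst_word f v)"
proof (induction u)
  case Nil
  then show ?case by (simp add: subst_word_def)
next
  case (Cons x u)
  then show ?case
    using assms foldr_push_assoc[OF reduced_subst_word]
    by (simp add: subst_word_push_letter subst_word_Cons)
qed

text \<open>Letters suffice: the outer substitution is multiplicative, so the letters of
  \<open>w\<close> can be peeled off one at a time.\<close>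

lemma subst_word_subst_word:
  assumes "inverse_compatible f" "\<And>x. subst_word f (g x) = [x]" "reduced w"
  shows "subst_word f (subst_word g w) = w"
  using assms(3)
proof (induction w)
  case Nil
  then show ?case by (simp add: subst_word_def)
next
  case (Cons x w)
  have "subst_word f (subst_word g (x # w)) = push_letter x w"
    using Cons assms by (simp add: subst_word_Cons subst_word_foldr_push reduced_Cons)
  also have "\<dots> = x # w"
    using Cons.prems by (cases w) (auto simp: reduced_Cons)
  finally show ?case .
qed

lemma subst_word_closed:
  assumes "\<And>x. snd x < n \<Longrightarrow> snd ` set (f x) \<subseteq> {..<n}" "w \<in> carrier (free_group n)"
  shows "subst_word f w \<in> carrier (free_group n)"
proof -
  have "set (subst_word f w) \<subseteq> (\<Union>x\<in>set w. set (f x))"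
    using set_foldr_push[of "concat (map f w)" "[]"] by (simp add: subst_word_def)
  then have "snd ` set (subst_word f w) \<subseteq> (\<Union>x\<in>set w. snd ` set (f x))"
    by blast
  also have "\<dots> \<subseteq> {..<n}"
    using assms by fastforce
  finally show ?thesis
    by (simp add: reduced_subst_word)
qed

text \<open>The source of all explicit lifts: a letter substitution with an explicit inverse is an
  automorphism, and the reduced palindromes \<open>f (True, i)\<close> are literally the images of
  the generators.\<close>

lemma subst_word_lift:
  assumes f: "inverse_compatible f" "\<And>x. snd x < n \<Longrightarrow> snd ` set (f x) \<subseteq> {..<n}"
    and g: "inverse_compatible g" "\<And>x. snd x < n \<Longrightarrow> snd ` set (g x) \<subseteq> {..<n}"
    and fg: "\<And>x. subst_word f (g x) = [x]" "\<And>x. subst_word g (f x) = [x]"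
    and palindromic: "\<And>i. palindromic (f (True, i))" and reduced: "\<And>i. reduced (f (True, i))"
  shows "mat n n (\<lambda>(i, j). exponent_sum j (f (True, i))) \<in> abelianization n ` PiA n"
proof -
  let ?F = "free_group n"
  \<comment> \<open>\<open>Bij\<close> contains only extensional functions, hence the
    restriction.\<close>
  define \<alpha> where "\<alpha> = restrict (subst_word f) (carrier ?F)"
  note closed = subst_word_closed[OF f(2)] subst_word_closed[OF g(2)]
  have "bij_betw (subst_word f) (carrier ?F) (carrier ?F)"
    by (rule bij_betw_byWitness[of _ "subst_word g"])
      (use closed in \<open>auto simp: subst_word_subst_word f g fg simp del: free_group_simps(1)\<close>,
       auto simp: subst_word_subst_word f g fg)
  then have "\<alpha> \<in> Bij (carrier ?F)"
    by (simp add: Bij_def \<alpha>_def del: free_group_simps)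
  moreover have "\<alpha> \<in> hom ?F ?F"
    using closed(1) monoid.m_closed[OF group.is_monoid[OF group_free_group[of n]]]
    by (auto simp: hom_def \<alpha>_def subst_word_foldr_push[OF f(1)] simp del: free_group_simps(1))
  ultimately have "\<alpha> \<in> auto ?F"
    by (simp add: auto_def)
  moreover have gen: "\<alpha> (gen i) = f (True, i)" if "i < n" for i
  proof -
    have "\<alpha> (gen i) = subst_word f (gen i)"
      using gen_in_free_group[OF that] by (simp add: \<alpha>_def)
    then show ?thesis
      by (simp add: gen_def subst_word_def foldr_push_Nil reduced)
  qed
  ultimately have "\<alpha> \<in> PiA n"
    by (simp add: PiA_def palindromic)
  moreover have "abelianization n \<alpha> = mat n n (\<lambda>(i, j). exponent_sum j (f (True, i)))"
    by (rule eq_matI) (auto simp: abelianization_def gen)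
  ultimately show ?thesis
    by (metis image_eqI)
qed

section \<open>Lifts of signed permutation matrices and elementary matrices\<close>

definition signed_perm_mat :: "nat \<Rightarrow> (nat \<Rightarrow> bool) \<Rightarrow> (nat \<Rightarrow> nat) \<Rightarrow> int mat" where
  "signed_perm_mat n s p = mat n n (\<lambda>(i, j). if j = p i then if s i then 1 else - 1 else 0)"

lemma signed_perm_mat_lift:
  assumes "p permutes {..<n}"
  shows "signed_perm_mat n s p \<in> abelianization n ` PiA n"
proof -
  define q where "q = inv_into UNIV p"
  \<comment> \<open>Equality of booleans multiplies signs. The sign is attached to the source index,
    so the inverse \<open>g\<close> looks it up at \<open>q i\<close>.\<close>
  define f :: "letter \<Rightarrow> letter list" where "f = (\<lambda>(b, i). [(b = s i, p i)])"
  define g :: "letter \<Rightarrow> letter list" where "g = (\<lambda>(b, i). [(b = s (q i), q i)])"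
  have q: "p (q i) = i" "q (p i) = i" for i
    unfolding q_def using permutes_inverses[OF assms] by auto
  have p: "p i < n" "q i < n" if "i < n" for i
    using that permutes_in_image[OF assms] permutes_in_image[OF permutes_inv[OF assms]] by (auto simp: q_def)
  have "mat n n (\<lambda>(i, j). exponent_sum j (f (True, i))) \<in> abelianization n ` PiA n"
  proof (rule subst_word_lift)
    show "inverse_compatible f" "inverse_compatible g"
      by (auto simp: inverse_compatible_def f_def g_def inv_letter_def)
    show "subst_word f (g x) = [x]" "subst_word g (f x) = [x]" for x
      by (cases x; auto simp: subst_word_def f_def g_def q)+
  qed (auto simp: f_def g_def p palindromic_def reduced_Cons)
  also have "mat n n (\<lambda>(i, j). exponent_sum j (f (True, i))) = signed_perm_mat n s p"
    by (rule eq_matI) (auto simp: f_def signed_perm_mat_def exponent_sum_Cons)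
  finally show ?thesis .
qed

lemma addrow_mat_lift:
  assumes "i < n" "j < n" "i \<noteq> j" "e = 2 \<or> e = (- 2 :: int)"
  shows "addrow_mat n e i j \<in> abelianization n ` PiA n"
proof -
  \<comment> \<open>The test \<open>b = c\<close> inverts the outer letters together with the middle
    one, as the inverse word requires. Outer letters of opposite sign cancel, so
    \<open>f (\<not> c)\<close> is the inverse of \<open>f c\<close>.\<close>
  define f :: "bool \<Rightarrow> letter \<Rightarrow> letter list" where
    "f c = (\<lambda>(b, l). if l = i then [(b = c, j), (b, i), (b = c, j)] else [(b, l)])" for c
  define c where "c \<longleftrightarrow> e = 2"
  have inv: "subst_word (f c) (f (\<not> c) x) = [x]" for c x
    using assms(3) by (cases x) (auto simp: subst_word_def f_def inv_letter_def)
  have "mat n n (\<lambda>(l, k). exponent_sum k (f c (True, l))) \<in> abelianization n ` PiA n"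
  proof (rule subst_word_lift)
    show "inverse_compatible (f c)" "inverse_compatible (f (\<not> c))"
      by (auto simp: inverse_compatible_def f_def inv_letter_def)
    show "subst_word (f c) (f (\<not> c) x) = [x]" "subst_word (f (\<not> c)) (f c x) = [x]" for x
      using inv[of c x] inv[of "\<not> c" x] by simp_all
  qed (use assms in \<open>auto simp: f_def palindromic_def reduced_Cons inv_letter_def split: if_splits\<close>)
  also have "mat n n (\<lambda>(l, k). exponent_sum k (f c (True, l))) = addrow_mat n e i j"
    using assms by (intro eq_matI) (auto simp: f_def c_def exponent_sum_Cons)
  finally show ?thesis .
qed

section \<open>Parity of the entries\<close>

lemma mult_mat_entry:
  assumes "A \<in> carrier_mat n n" "B \<in> carrier_mat n n" "i < n" "j < n"
  shows "(A * B) $$ (i, j) = (\<Sum>l<n. A $$ (i, l) * B $$ (l, j))"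
  using assms by (simp add: scalar_prod_def atLeast0LessThan)

lemma of_int_bit: "(of_int a :: bit) = (if odd a then 1 else 0)"
  by (cases "even a") (auto elim!: evenE oddE)

lemma GL_hat_iff:
  "A \<in> GL_hat n \<longleftrightarrow> A \<in> GL_int n \<and>
    (\<exists>p. p permutes {..<n} \<and> (\<forall>i<n. \<forall>j<n. odd (A $$ (i, j)) \<longleftrightarrow> j = p i))"
proof -
  have "(map_mat of_int A :: bit mat) = mat n n (\<lambda>(i, j). if j = p i then 1 else 0) \<longleftrightarrow>
      (\<forall>i<n. \<forall>j<n. odd (A $$ (i, j)) \<longleftrightarrow> j = p i)" if "A \<in> carrier_mat n n" for p
    using that by (auto simp: mat_eq_iff of_int_bit split: if_splits)
  then show ?thesis
    unfolding GL_hat_def permutation_matrices_def by (auto simp: GL_int_iff)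
qed

text \<open>Let \<open>p\<close> pick the column of the odd entry in each row; uniqueness within
  columns makes it injective, and finiteness makes it bijective.\<close>

lemma odd_entries_permutation_iff:
  "(\<exists>p. p permutes {..<n} \<and> (\<forall>i<n. \<forall>j<n. odd (A $$ (i, j)) \<longleftrightarrow> j = p i)) \<longleftrightarrow>
    (\<forall>i<n. \<exists>!j. j < n \<and> odd (A $$ (i, j))) \<and> (\<forall>j<n. \<exists>!i. i < n \<and> odd (A $$ (i, j)))"
    (is "?L \<longleftrightarrow> ?rows \<and> ?cols")
proof
  assume ?L
  then obtain p where p: "p permutes {..<n}" and odd: "\<And>i j. i < n \<Longrightarrow> j < n \<Longrightarrow> odd (A $$ (i, j)) \<longleftrightarrow> j = p i"
    by blast
  have bij: "bij_betw p {..<n} {..<n}"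
    by (rule permutes_imp_bij[OF p])
  have ?rows
    using odd bij_betwE[OF bij] by auto
  moreover have ?cols
  proof (intro allI impI)
    fix j assume "j < n"
    then obtain i where "i < n" "j = p i"
      using bij by (auto simp: bij_betw_def image_iff set_eq_iff)
    then show "\<exists>!i. i < n \<and> odd (A $$ (i, j))"
      using odd \<open>j < n\<close> injD[OF permutes_inj[OF p]] by blast
  qed
  ultimately show "?rows \<and> ?cols" ..
next
  assume rc: "?rows \<and> ?cols"
  \<comment> \<open>\<open>permutes\<close> demands the identity outside
    \<open>{..<n}\<close>.\<close>
  define p where "p i = (if i < n then THE j. j < n \<and> odd (A $$ (i, j)) else i)" for i
  have p: "p i < n \<and> odd (A $$ (i, p i))" if "i < n" for i
    using theI'[of "\<lambda>j. j < n \<and> odd (A $$ (i, j))"] rc that by (simp add: p_def)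
  have "p permutes {..<n}"
  proof (rule bij_imp_permutes)
    have "inj_on p {..<n}"
      using p rc by (intro inj_onI) (metis lessThan_iff)
    moreover from this have "p ` {..<n} = {..<n}"
      using p by (intro endo_inj_surj) auto
    ultimately show "bij_betw p {..<n} {..<n}"
      by (simp add: bij_betw_def)
  qed (simp add: p_def)
  moreover have "odd (A $$ (i, j)) \<longleftrightarrow> j = p i" if "i < n" "j < n" for i j
  proof -
    have "\<exists>!j. j < n \<and> odd (A $$ (i, j))"
      using rc \<open>i < n\<close> by simp
    then show ?thesis
      using p[OF \<open>i < n\<close>] \<open>j < n\<close> by auto
  qed
  ultimately show ?L by blast
qed

text \<open>Invertibility supplies the rest: a row without odd entries would make a diagonal entry
  of \<open>A * B\<close> even, and the inverse shows that different rows have their odd entries in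
  different columns.\<close>

lemma GL_int_odd_permutation:
  assumes "A \<in> GL_int n"
    and unique: "\<And>i j k. i < n \<Longrightarrow> j < n \<Longrightarrow> k < n \<Longrightarrow> odd (A $$ (i, j)) \<Longrightarrow> odd (A $$ (i, k)) \<Longrightarrow> j = k"
  shows "\<exists>p. p permutes {..<n} \<and> (\<forall>i<n. \<forall>j<n. odd (A $$ (i, j)) \<longleftrightarrow> j = p i)"
proof -
  obtain B where A: "A \<in> carrier_mat n n" and B: "B \<in> carrier_mat n n" "A * B = 1\<^sub>m n"
    using assms(1) by (auto simp: GL_int_iff)
  have sum: "(\<Sum>l<n. A $$ (i, l) * B $$ (l, j)) = (if i = j then 1 else 0)" if "i < n" "j < n" for i j
    using mult_mat_entry[OF A B(1) that] that by (simp add: B(2))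
  have "\<exists>j<n. odd (A $$ (i, j))" if "i < n" for i
  proof (rule ccontr)
    assume "\<not> ?thesis"
    then have "even (\<Sum>l<n. A $$ (i, l) * B $$ (l, i))"
      by (intro dvd_sum) auto
    then show False
      using sum[OF that that] by simp
  qed
  then obtain q where q: "\<And>i. i < n \<Longrightarrow> q i < n \<and> odd (A $$ (i, q i))"
    by metis
  define p where "p i = (if i < n then q i else i)" for i
  have odd: "odd (A $$ (i, j)) \<longleftrightarrow> j = p i" if "i < n" "j < n" for i j
    using q unique that by (auto simp: p_def)
  \<comment> \<open>Modulo 2, row \<open>i\<close> of \<open>A * B\<close> is row \<open>p i\<close>
    of \<open>B\<close>. That row of \<open>B\<close> is therefore a unit vector modulo 2 that
    determines \<open>i\<close>, which makes \<open>p\<close> injective.\<close>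
  have B_odd: "odd (B $$ (p i, j)) \<longleftrightarrow> i = j" if "i < n" "j < n" for i j
  proof -
    have "p i < n" "odd (A $$ (i, p i))"
      using q that by (auto simp: p_def)
    have ev: "even (\<Sum>l\<in>{..<n} - {p i}. A $$ (i, l) * B $$ (l, j))"
      using odd that by (intro dvd_sum) auto
    have eq: "(if i = j then 1 else 0) =
        A $$ (i, p i) * B $$ (p i, j) + (\<Sum>l\<in>{..<n} - {p i}. A $$ (i, l) * B $$ (l, j))"
      using sum[OF that] \<open>p i < n\<close> by (subst sum.remove[symmetric]) auto
    have "odd ((if i = j then 1 else 0) :: int) \<longleftrightarrow> odd (A $$ (i, p i) * B $$ (p i, j))"
      by (simp only: eq even_add ev simp_thms)
    then show ?thesis
      using \<open>odd (A $$ (i, p i))\<close> by (cases "i = j") simp_all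
  qed
  have "p permutes {..<n}"
  proof (rule bij_imp_permutes)
    have "inj_on p {..<n}"
      using B_odd by (intro inj_onI) (metis lessThan_iff)
    moreover from this have "p ` {..<n} = {..<n}"
      using q by (intro endo_inj_surj) (auto simp: p_def)
    ultimately show "bij_betw p {..<n} {..<n}"
      by (simp add: bij_betw_def)
  qed (simp add: p_def)
  then show ?thesis
    using odd by blast
qed

lemma abelianization_GL_hat:
  assumes "\<alpha> \<in> PiA n"
  shows "abelianization n \<alpha> \<in> GL_hat n"
proof -
  have "abelianization n \<alpha> \<in> GL_int n"
    using assms by (simp add: PiA_def abelianization_GL_int)
  moreover have "j = k" if "i < n" "j < n" "k < n" "odd (abelianization n \<alpha> $$ (i, j))"
    "odd (abelianization n \<alpha> $$ (i, k))" for i j k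
    using that assms palindromic_odd_exponent_unique[of "\<alpha> (gen i)" j k]
    by (simp add: abelianization_def PiA_def)
  ultimately show ?thesis
    unfolding GL_hat_iff using GL_int_odd_permutation by blast
qed

section \<open>Elimination by even row operations\<close>

text \<open>Loop invariant of the elimination, which clears columns from left to right. The parity
  clause, membership in the level 2 congruence subgroup, keeps the diagonal entries odd and hence
  nonzero as pivots.\<close>

definition diagonal_upto :: "nat \<Rightarrow> nat \<Rightarrow> int mat \<Rightarrow> bool" where
  "diagonal_upto n k A \<longleftrightarrow> A \<in> GL_int n \<and>
    (\<forall>i<n. \<forall>j<n. odd (A $$ (i, j)) \<longleftrightarrow> i = j) \<and>
    (\<forall>j<k. \<forall>i<n. i \<noteq> j \<longrightarrow> A $$ (i, j) = 0)"

text \<open>Columns before \<open>k\<close> are diagonal with nonzero pivots, so row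
  \<open>k\<close> of the inverse \<open>B\<close> vanishes before column \<open>k\<close>. With
  zeros below the pivot, entry \<open>(k, k)\<close> of \<open>B * A\<close> is just the product of
  the two pivots. Entries above the pivot may be nonzero.\<close>

lemma pivot_unit:
  assumes "diagonal_upto n k A" "k < n" "\<And>i. k < i \<Longrightarrow> i < n \<Longrightarrow> A $$ (i, k) = 0"
  shows "\<bar>A $$ (k, k)\<bar> = 1"
proof -
  obtain B where A: "A \<in> carrier_mat n n" and B: "B \<in> carrier_mat n n" "B * A = 1\<^sub>m n"
    using assms(1) by (auto simp: GL_int_iff diagonal_upto_def)
  have sum: "(\<Sum>l<n. B $$ (i, l) * A $$ (l, j)) = (if i = j then 1 else 0)" if "i < n" "j < n" for i j
    using mult_mat_entry[OF B(1) A that] that by (simp add: B(2))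
  have B0: "B $$ (k, j) = 0" if "j < k" for j
  proof -
    have "(\<Sum>l<n. B $$ (k, l) * A $$ (l, j)) = B $$ (k, j) * A $$ (j, j)"
      using assms(1,2) that by (subst sum.remove[of _ j]) (auto simp: diagonal_upto_def)
    moreover have "odd (A $$ (j, j))"
      using assms(1,2) that by (simp add: diagonal_upto_def)
    ultimately show ?thesis
      using sum[of k j] assms(2) that by auto
  qed
  have "B $$ (k, l) * A $$ (l, k) = 0" if "l < n" "l \<noteq> k" for l
    using assms(3)[of l] B0[of l] that by (cases "l < k") auto
  then have "(\<Sum>l<n. B $$ (k, l) * A $$ (l, k)) = B $$ (k, k) * A $$ (k, k)"
    using assms(2) by (subst sum.remove[of _ k]) (auto intro!: sum.neutral simp del: mult_eq_0_iff)
  then have "B $$ (k, k) * A $$ (k, k) = 1"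
    using sum[of k k] assms(2) by simp
  then show ?thesis
    by (metis mult.commute abs_zmult_eq_1 abs_one)
qed

text \<open>Every column satisfies the conditions of \<open>pivot_unit\<close>, so the diagonal
  entries are signs and the matrix is a signed permutation matrix for the identity.\<close>

lemma diagonal_lift:
  assumes "diagonal_upto n n A"
  shows "A \<in> abelianization n ` PiA n"
proof -
  have unit: "\<bar>A $$ (i, i)\<bar> = 1" if "i < n" for i
    using assms that by (intro pivot_unit[of n]) (auto simp: diagonal_upto_def)
  have "signed_perm_mat n (\<lambda>i. A $$ (i, i) = 1) id = A"
  proof (rule eq_matI)
    fix i j assume "i < dim_row A" "j < dim_col A"
    then have ij: "i < n" "j < n"
      using assms by (auto simp: diagonal_upto_def GL_int_iff)
    then show "signed_perm_mat n (\<lambda>i. A $$ (i, i) = 1) id $$ (i, j) = A $$ (i, j)"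
      using assms unit[of i] by (auto simp: signed_perm_mat_def diagonal_upto_def)
  qed (use assms in \<open>auto simp: signed_perm_mat_def diagonal_upto_def GL_int_iff\<close>)
  then show ?thesis
    using signed_perm_mat_lift[OF permutes_id] by metis
qed

lemma abelianization_image_GL_int: "A \<in> abelianization n ` PiA n \<Longrightarrow> A \<in> GL_int n"
  by (auto simp: PiA_def abelianization_GL_int)

text \<open>Since \<open>k \<le> j\<close>, row \<open>j\<close> vanishes in the cleared columns,
  which therefore stay unchanged; adding an even multiple preserves parities.\<close>

lemma addrow_diagonal_upto:
  assumes "diagonal_upto n k A" "i < n" "j < n" "i \<noteq> j" "k \<le> j" "e = 2 \<or> e = - 2"
  shows "diagonal_upto n k (addrow e i j A)"
proof -
  have A: "A \<in> carrier_mat n n"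
    using assms(1) by (simp add: diagonal_upto_def GL_int_iff)
  have "addrow e i j A \<in> GL_int n"
    using assms addrow_mat[OF A assms(3), of e i] abelianization_image_GL_int[OF addrow_mat_lift[OF assms(2-4,6)]]
    by (simp add: diagonal_upto_def GL_int_mult)
  moreover have "even e"
    using assms(6) by auto
  ultimately show ?thesis
    using assms A by (auto simp: diagonal_upto_def)
qed

text \<open>The operation is undone by the elementary matrix for \<open>- e\<close>, which lifts
  too.\<close>

lemma addrow_lift:
  assumes "A \<in> carrier_mat n n" "addrow e i j A \<in> abelianization n ` PiA n"
    and "i < n" "j < n" "i \<noteq> j" "e = 2 \<or> e = - 2"
  shows "A \<in> abelianization n ` PiA n"
proof -
  have "addrow_mat n (- e) i j * addrow e i j A = addrow_mat n (- e) i j * addrow_mat n e i j * A"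
    using assms by (simp add: addrow_mat assoc_mult_mat[of _ n n _ n _ n])
  also have "\<dots> = A"
    using addrow_mat_inv[OF assms(3-5), of "- e"] assms(1) by simp
  finally show ?thesis
    using abelianization_PiA_mult[OF addrow_mat_lift[OF assms(3-5), of "- e"] assms(2)] assms(6)
    by auto
qed

text \<open>If no operation \<open>row i \<plusminus>= 2 row j\<close> with \<open>j \<ge> k\<close> shortens column \<open>k\<close>, then the nonzero
  entries in rows \<open>\<ge> k\<close> have equal absolute values. Only the pivot is odd, so it is the only one,
  hence a unit, and the even entries above it are too small to be nonzero.\<close>

lemma reduced_column:
  assumes diag: "diagonal_upto n k A" and "k < n"
    and min: "\<And>i j. i < n \<Longrightarrow> j < n \<Longrightarrow> i \<noteq> j \<Longrightarrow> k \<le> j \<Longrightarrow> A $$ (j, k) \<noteq> 0 \<Longrightarrow>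
      \<bar>A $$ (i, k)\<bar> \<le> \<bar>A $$ (j, k)\<bar>"
  shows "diagonal_upto n (Suc k) A"
proof -
  have odd: "odd (A $$ (i, k)) \<longleftrightarrow> i = k" if "i < n" for i
    using diag that \<open>k < n\<close> by (auto simp: diagonal_upto_def)
  then have "A $$ (k, k) \<noteq> 0"
    using \<open>k < n\<close> by force
  then have le: "\<bar>A $$ (i, k)\<bar> \<le> \<bar>A $$ (k, k)\<bar>" if "i < n" for i
    using min[of i k] that \<open>k < n\<close> by (cases "i = k") auto
  have "A $$ (i, k) = 0" if "k < i" "i < n" for i
  proof (rule ccontr)
    assume "A $$ (i, k) \<noteq> 0"
    then have "\<bar>A $$ (i, k)\<bar> = \<bar>A $$ (k, k)\<bar>"
      using min[of k i] le[of i] that \<open>k < n\<close> by auto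
    then show False
      using odd[of i] odd[of k] that \<open>k < n\<close> by (metis even_abs_add_iff even_add less_irrefl abs_eq_iff even_minus)
  qed
  then have "\<bar>A $$ (k, k)\<bar> = 1"
    by (rule pivot_unit[OF diag \<open>k < n\<close>])
  have "A $$ (i, k) = 0" if "i < n" "i \<noteq> k" for i
  proof -
    have "even (A $$ (i, k))" "\<bar>A $$ (i, k)\<bar> \<le> 1"
      using odd le[of i] that \<open>\<bar>A $$ (k, k)\<bar> = 1\<close> by auto
    then show ?thesis
      by presburger
  qed
  then show ?thesis
    using diag by (auto simp: diagonal_upto_def less_Suc_eq)
qed

text \<open>Euclidean descent on the sum of the absolute values in column \<open>k\<close>; once no
  admissible pair of rows is left, \<open>reduced_column\<close> applies.\<close>

lemma eliminate_column:
  assumes "k < n" and lift: "\<And>A. diagonal_upto n (Suc k) A \<Longrightarrow> A \<in> abelianization n ` PiA n"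
    and "diagonal_upto n k A"
  shows "A \<in> abelianization n ` PiA n"
  using assms(3)
proof (induction "nat (\<Sum>i<n. \<bar>A $$ (i, k)\<bar>)" arbitrary: A rule: less_induct)
  case less
  have A: "A \<in> carrier_mat n n"
    using less.prems by (simp add: diagonal_upto_def GL_int_iff)
  show ?case
  proof (cases "\<exists>i j. i < n \<and> j < n \<and> i \<noteq> j \<and> k \<le> j \<and> A $$ (j, k) \<noteq> 0 \<and> \<bar>A $$ (j, k)\<bar> < \<bar>A $$ (i, k)\<bar>")
    case False
    then have "diagonal_upto n (Suc k) A"
      by (intro reduced_column[OF less.prems assms(1)]) (meson not_less)
    then show ?thesis by (rule lift)
  next
    case True
    then obtain i j where ij: "i < n" "j < n" "i \<noteq> j" "k \<le> j"
      and "A $$ (j, k) \<noteq> 0" "\<bar>A $$ (j, k)\<bar> < \<bar>A $$ (i, k)\<bar>"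
      by blast
    \<comment> \<open>Write x and y for the entries in rows \<open>i\<close> and \<open>j\<close>,
      and give \<open>e\<close> the sign that moves x towards zero. As 0 < |y| < |x|, the number |x|
      - 2|y| lies strictly between -|x| and |x|.\<close>
    then obtain e :: int where e: "e = 2 \<or> e = - 2"
      and smaller: "\<bar>e * A $$ (j, k) + A $$ (i, k)\<bar> < \<bar>A $$ (i, k)\<bar>"
      by (cases "A $$ (i, k) > 0 \<longleftrightarrow> A $$ (j, k) > 0") (force+)
    have "(\<Sum>l<n. \<bar>addrow e i j A $$ (l, k)\<bar>) < (\<Sum>l<n. \<bar>A $$ (l, k)\<bar>)"
      using A ij(1) smaller assms(1)
      by (intro sum_strict_mono_ex1) auto
    moreover have "0 \<le> (\<Sum>l<n. \<bar>addrow e i j A $$ (l, k)\<bar>)"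
      by (simp add: sum_nonneg)
    ultimately have "nat (\<Sum>l<n. \<bar>addrow e i j A $$ (l, k)\<bar>) < nat (\<Sum>l<n. \<bar>A $$ (l, k)\<bar>)"
      by linarith
    then have "addrow e i j A \<in> abelianization n ` PiA n"
      by (rule less.hyps) (intro addrow_diagonal_upto less.prems ij e)
    then show ?thesis
      by (rule addrow_lift[OF A _ ij(1-3) e])
  qed
qed

lemma diagonal_upto_lift: "diagonal_upto n 0 A \<Longrightarrow> A \<in> abelianization n ` PiA n"
proof -
  have "diagonal_upto n k A \<Longrightarrow> A \<in> abelianization n ` PiA n" if "k \<le> n" for k
    using that
  \<comment> \<open>Downward induction, from \<open>n\<close> cleared columns to none.\<close>
  proof (induction k arbitrary: A rule: inc_induct)
    case base
    then show ?case by (rule diagonal_lift)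
  next
    case (step k)
    then show ?case by (blast intro: eliminate_column)
  qed
  from this[of 0] show "diagonal_upto n 0 A \<Longrightarrow> A \<in> abelianization n ` PiA n"
    by simp
qed

section \<open>Reduction to matrices congruent to the identity modulo 2\<close>

lemma signed_perm_mat_mult:
  assumes "A \<in> carrier_mat n n" "p permutes {..<n}" "i < n" "j < n"
  shows "(signed_perm_mat n (\<lambda>_. True) p * A) $$ (i, j) = A $$ (p i, j)"
proof -
  have "(signed_perm_mat n (\<lambda>_. True) p * A) $$ (i, j) = (\<Sum>l<n. if l = p i then A $$ (l, j) else 0)"
    using assms by (subst mult_mat_entry[of _ n])
      (auto simp: signed_perm_mat_def intro!: sum.cong simp del: sum.delta sum.delta')
  also have "\<dots> = A $$ (p i, j)"
    using permutes_in_image[OF assms(2), of i] assms(3) by simp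
  finally show ?thesis .
qed

lemma GL_hat_lift:
  assumes "A \<in> GL_hat n"
  shows "A \<in> abelianization n ` PiA n"
proof -
  obtain p where GL: "A \<in> GL_int n" and p: "p permutes {..<n}"
    and odd: "\<And>i j. i < n \<Longrightarrow> j < n \<Longrightarrow> odd (A $$ (i, j)) \<longleftrightarrow> j = p i"
    using assms by (auto simp: GL_hat_iff)
  have A: "A \<in> carrier_mat n n"
    using GL by (simp add: GL_int_iff)
  define q where "q = inv_into UNIV p"
  have q: "q permutes {..<n}" "\<And>i. p (q i) = i" "\<And>i. q (p i) = i"
    unfolding q_def using permutes_inv[OF p] permutes_inverses[OF p] by auto
  have less: "p i < n" "q i < n" if "i < n" for i
    using that permutes_in_image[OF p] permutes_in_image[OF q(1)] by auto
  \<comment> \<open>Row \<open>i\<close> of \<open>Q * A\<close> is row \<open>q i\<close> of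
    \<open>A\<close>, whose odd entry lies in column \<open>p (q i) = i\<close>; so
    \<open>Q * A\<close> is the identity modulo 2. Multiplying by \<open>P\<close> restores the
    order of the rows.\<close>
  define P Q where "P = signed_perm_mat n (\<lambda>_. True) p" and "Q = signed_perm_mat n (\<lambda>_. True) q"
  have PQ: "P \<in> abelianization n ` PiA n" "Q \<in> abelianization n ` PiA n"
    by (simp_all only: P_def Q_def signed_perm_mat_lift p q(1))
  then have "Q * A \<in> GL_int n"
    using GL by (blast intro: GL_int_mult abelianization_image_GL_int)
  moreover have "odd ((Q * A) $$ (i, j)) \<longleftrightarrow> i = j" if "i < n" "j < n" for i j
    using that less odd[of "q i" j] q by (auto simp: Q_def signed_perm_mat_mult[OF A q(1)])
  ultimately have "Q * A \<in> abelianization n ` PiA n"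
    by (intro diagonal_upto_lift) (simp add: diagonal_upto_def)
  then have "P * (Q * A) \<in> abelianization n ` PiA n"
    by (rule abelianization_PiA_mult[OF PQ(1)])
  moreover have "P * (Q * A) = A"
  proof (rule eq_matI)
    fix i j assume "i < dim_row A" "j < dim_col A"
    then have ij: "i < n" "j < n"
      using A by auto
    have QA: "Q * A \<in> carrier_mat n n"
      unfolding Q_def signed_perm_mat_def by (rule mult_carrier_mat[OF mat_carrier A])
    have "(P * (Q * A)) $$ (i, j) = (Q * A) $$ (p i, j)"
      unfolding P_def by (rule signed_perm_mat_mult[OF QA p ij])
    also have "\<dots> = A $$ (q (p i), j)"
      unfolding Q_def by (rule signed_perm_mat_mult[OF A q(1) less(1)[OF ij(1)] ij(2)])
    finally show "(P * (Q * A)) $$ (i, j) = A $$ (i, j)"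
      by (simp add: q)
  qed (use A in \<open>auto simp: P_def signed_perm_mat_def\<close>)
  ultimately show ?thesis by simp
qed

theorem theorem1p1:
  fixes n :: nat
  assumes "n \<ge> 1"
  shows "abelianization n ` PiA n = GL_hat n \<and>
    GL_hat n = {A \<in> GL_int n.
      (\<forall>i<n. \<exists>!j. j < n \<and> odd (A $$ (i, j))) \<and>
      (\<forall>j<n. \<exists>!i. i < n \<and> odd (A $$ (i, j)))}"
proof
  show "abelianization n ` PiA n = GL_hat n"
    using abelianization_GL_hat GL_hat_lift by blast
  show "GL_hat n = {A \<in> GL_int n.
      (\<forall>i<n. \<exists>!j. j < n \<and> odd (A $$ (i, j))) \<and>
      (\<forall>j<n. \<exists>!i. i < n \<and> odd (A $$ (i, j)))}"
    by (simp add: set_eq_iff GL_hat_iff odd_entries_permutation_iff)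
qed

end
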